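(* Let $G$ be a graph that is $P_5$-free and $C_5$-free. Then $G$ is $2$-divisible; that is, for every induced subgraph $H$ of $G$ having at least one edge, $V(H)$ can be partitioned into two sets $A,B$ such that $\omega(A)<\omega(H)$ and $\omega(B)<\omega(H)$.
   Context: All graphs are finite and simple. $P_5$ is the path on $5$ vertices and $C_5$ is the cycle on $5$ vertices. For a graph $F$, a graph $G$ is $F$-free if no induced subgraph of $G$ is isomorphic to $F$. $\omega(H)$ denotes the clique number of $H$ (the maximum size of a set of pairwise adjacent vertices, with value $0$ for the graph with no vertices), and for a set $X$ of vertices, $\omega(X)$ means the clique number of the subgraph induced by $X$. Parts of a partition are allowed to be empty. *)

theory Defs
  imports Graph_Theory.Graph_Theory
begin

text \<open>
  A finite simple graph is a digraph satisfying the locale \<^locale>\<open>graph\<close>: finite, symmetric,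
  without loops and without parallel arcs.  An undirected edge is thus a pair of opposite arcs.
\<close>

text \<open>The vertices \<open>0, \<dots>, n - 1\<close> are joined in this order.\<close>

definition path_graph :: "nat \<Rightarrow> (nat, nat \<times> nat) pre_digraph" where
  "path_graph n = with_proj \<lparr> pverts = {0..<n},
     parcs = {(i, j). i < n \<and> j < n \<and> (j = Suc i \<or> i = Suc j)} \<rparr>"

text \<open>This is the cycle on \<open>n\<close> vertices only for \<open>n \<ge> 3\<close>.\<close>

definition cycle_graph :: "nat \<Rightarrow> (nat, nat \<times> nat) pre_digraph" where
  "cycle_graph n = with_proj \<lparr> pverts = {0..<n},
     parcs = {(i, j). i < n \<and> j < n \<and> (j = Suc i mod n \<or> i = Suc j mod n)} \<rparr>"

definition free_of :: "('c, 'd) pre_digraph \<Rightarrow> ('a, 'b) pre_digraph \<Rightarrow> bool" where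
  "free_of F G \<longleftrightarrow> \<not> (\<exists>H. induced_subgraph H G \<and> digraph_iso H F)"

definition clique :: "('a, 'b) pre_digraph \<Rightarrow> 'a set \<Rightarrow> bool" where
  "clique G K \<longleftrightarrow> K \<subseteq> verts G \<and> pairwise (\<lambda>u v. u \<rightarrow>\<^bsub>G\<^esub> v) K"

text \<open>
  Meaningful for graphs with finitely many vertices.  The empty set is a clique, so the maximum
  is taken over a nonempty set, and the graph without vertices has clique number 0.
\<close>

definition clique_number :: "('a, 'b) pre_digraph \<Rightarrow> nat" where
  "clique_number G = Max {card K | K. clique G K}"

definition two_divisible :: "('a, 'b) pre_digraph \<Rightarrow> bool" where
  "two_divisible G \<longleftrightarrow>
     (\<forall>H. induced_subgraph H G \<and> arcs H \<noteq> {} \<longrightarrow>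
       (\<exists>A B. A \<union> B = verts H \<and> A \<inter> B = {} \<and>
          clique_number (H \<restriction> A) < clique_number H \<and>
          clique_number (H \<restriction> B) < clique_number H))"

end

theory Submission
  imports Defs
begin

unbundle no funcset_syntax

text \<open>
  Let \<open>k \<ge> 2\<close> be the clique number of \<open>H\<close>.  Two nonadjacent neighbours of a vertex \<open>u\<close> have
  comparable neighbourhoods among the vertices that are not adjacent to \<open>u\<close>: private neighbours
  \<open>y\<close> and \<open>z\<close> of theirs would give an induced \<open>P\<^sub>5\<close> or \<open>C\<^sub>5\<close>.  Let \<open>W(u)\<close> be the set of the
  \<open>k\<close>-cliques that miss \<open>u\<close> and its neighbours.  If \<open>n\<close> is a neighbour of \<open>u\<close> whose trace on the
  non-neighbours of \<open>u\<close> is maximal, then \<open>W(n) \<subseteq> W(u)\<close>.  So if \<open>W(v)\<close> is minimal and contains a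
  clique \<open>K\<close> in the component of \<open>v\<close>, one can walk from \<open>v\<close> towards \<open>K\<close> through vertices \<open>u\<close> with
  \<open>W(u) = W(v)\<close>, and reaching \<open>K\<close> is absurd.  Hence the neighbourhood of \<open>v\<close> and its complement
  split the component of \<open>v\<close> as required, and the other components are treated in the same way.
\<close>

section \<open>Cliques, clique numbers and forbidden induced subgraphs\<close>

lemma (in wf_digraph) dominates_induce_subgraph_iff:
  "u \<rightarrow>\<^bsub>G \<restriction> A\<^esub> v \<longleftrightarrow> u \<rightarrow>\<^bsub>G\<^esub> v \<and> u \<in> A \<and> v \<in> A"
  by (auto simp: arcs_ends_conv)

lemma clique_induce_subgraph_iff:
  assumes "wf_digraph G" "A \<subseteq> verts G"
  shows "clique (G \<restriction> A) K \<longleftrightarrow> clique G K \<and> K \<subseteq> A"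
  using assms wf_digraph.dominates_induce_subgraph_iff[OF assms(1)]
  unfolding clique_def pairwise_def by auto

lemma clique_subset: "clique G K \<Longrightarrow> L \<subseteq> K \<Longrightarrow> clique G L"
  unfolding clique_def by (auto intro: pairwise_subset)

lemma
  assumes "finite (verts G)"
  shows clique_number_attained: "\<exists>K. clique G K \<and> card K = clique_number G"
    and card_le_clique_number: "\<And>K. clique G K \<Longrightarrow> card K \<le> clique_number G"
proof -
  let ?C = "{card K | K. clique G K}"
  have "finite {K. clique G K}"
    by (rule finite_subset[of _ "Pow (verts G)"]) (auto simp: clique_def assms)
  then have fin: "finite ?C"
    by simp
  have "clique G {}"
    by (simp add: clique_def)
  then have "?C \<noteq> {}"
    by blast
  with fin have "clique_number G \<in> ?C"
    unfolding clique_number_def by (rule Max_in)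
  then show "\<exists>K. clique G K \<and> card K = clique_number G"
    by auto
  show "card K \<le> clique_number G" if "clique G K" for K
    unfolding clique_number_def using fin that by (intro Max_ge) auto
qed

text \<open>A clique with more than \<open>k\<close> vertices contains one with exactly
  \<open>k\<close>, so excluding this single size is enough. Later bounds therefore take the form
  \<open>card K \<noteq> k\<close>.\<close>

lemma clique_number_less:
  assumes "finite (verts G)" "\<And>K. clique G K \<Longrightarrow> card K \<noteq> k"
  shows "clique_number G < k"
proof (rule ccontr)
  assume "\<not> clique_number G < k"
  moreover obtain K where "clique G K" "card K = clique_number G"
    using clique_number_attained[OF assms(1)] by blast
  ultimately obtain L where "L \<subseteq> K" "card L = k"
    by (metis not_less obtain_subset_with_card_n)
  with \<open>clique G K\<close> assms(2) show False
    by (blast intro: clique_subset)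
qed

text \<open>Sending each vertex to its position in \<open>xs\<close> would be an isomorphism from
  the subgraph induced by \<open>set xs\<close> onto the forbidden graph. Freeness thus becomes a
  finite check of adjacencies between list entries.\<close>

lemma free_of_not_nth_iff:
  fixes R :: "nat rel"
  assumes "digraph G"
    and free: "free_of (with_proj \<lparr> pverts = {0..<n}, parcs = R \<rparr>) G"
    and R: "R \<subseteq> {0..<n} \<times> {0..<n}"
    and xs: "distinct xs" "length xs = n" "set xs \<subseteq> verts G"
  shows "\<not> (\<forall>i<n. \<forall>j<n. xs ! i \<rightarrow>\<^bsub>G\<^esub> xs ! j \<longleftrightarrow> (i, j) \<in> R)"
proof
  assume iff: "\<forall>i<n. \<forall>j<n. xs ! i \<rightarrow>\<^bsub>G\<^esub> xs ! j \<longleftrightarrow> (i, j) \<in> R"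
  interpret digraph G by fact
  let ?H = "G \<restriction> set xs"
  define f where "f = the_inv_into {0..<n} ((!) xs)"
  \<comment> \<open>The arcs of the target are pairs of indices, so an arc goes to the positions of
    its two ends, and tail and head become the projections.\<close>
  define h where "h = \<lparr> iso_verts = f, iso_arcs = (\<lambda>e. (f (tail G e), f (head G e))),
    iso_head = snd, iso_tail = (fst :: nat \<times> nat \<Rightarrow> nat) \<rparr>"
  have bij: "bij_betw ((!) xs) {0..<n} (set xs)"
    using xs by (auto intro: bij_betw_nth)
  then have bij_f: "bij_betw f (set xs) {0..<n}"
    unfolding f_def by (rule bij_betw_the_inv_into)
  have f_nth: "f (xs ! i) = i" if "i < n" for i
    unfolding f_def using bij that by (intro the_inv_into_f_f) (auto simp: bij_betw_def)
  have nth_f: "xs ! f x = x" "f x < n" if "x \<in> set xs" for x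
    using that f_nth xs(2) by (auto simp: in_set_conv_nth)
  \<comment> \<open>Arcs with the same image have the same ends, and \<open>G\<close> has no
    parallel arcs.\<close>
  have "inj_on (iso_arcs h) (arcs ?H)"
  proof (rule inj_onI)
    fix d e
    assume "d \<in> arcs ?H" "e \<in> arcs ?H" "iso_arcs h d = iso_arcs h e"
    then have "arc_to_ends G d = arc_to_ends G e"
      using bij_f by (auto simp: h_def arc_to_ends_def bij_betw_def dest: inj_onD)
    with \<open>d \<in> arcs ?H\<close> \<open>e \<in> arcs ?H\<close> show "d = e"
      by (auto intro: no_multi_arcs)
  qed
  moreover have "wf_digraph ?H"
    by (rule wellformed_induce_subgraph)
  ultimately have "pre_digraph.digraph_isomorphism ?H h"
    using bij_f by (auto simp: pre_digraph.digraph_isomorphism_def h_def bij_betw_def)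
  moreover have "iso_arcs h ` arcs ?H = R"
  proof (intro equalityI subrelI)
    fix i j
    assume "(i, j) \<in> iso_arcs h ` arcs ?H"
    then obtain e where e: "e \<in> arcs G" "tail G e \<in> set xs" "head G e \<in> set xs"
      and ij: "i = f (tail G e)" "j = f (head G e)"
      by (auto simp: h_def)
    from e(1) have "tail G e \<rightarrow>\<^bsub>G\<^esub> head G e"
      by (auto simp: arcs_ends_conv)
    with e ij iff nth_f show "(i, j) \<in> R"
      by metis
  next
    fix i j
    assume "(i, j) \<in> R"
    with R iff have "i < n" "j < n" "xs ! i \<rightarrow>\<^bsub>G\<^esub> xs ! j"
      by auto
    moreover then obtain e where "e \<in> arcs G" "tail G e = xs ! i" "head G e = xs ! j"
      by auto
    ultimately show "(i, j) \<in> iso_arcs h ` arcs ?H"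
      using f_nth xs(2) by (intro rev_image_eqI[of e]) (auto simp: h_def)
  qed
  ultimately have "digraph_iso ?H (with_proj \<lparr> pverts = {0..<n}, parcs = R \<rparr>)"
    using bij_f unfolding digraph_iso_def
    by (intro exI[of _ h]) (auto simp: app_iso_def with_proj_def h_def bij_betw_def)
  moreover have "induced_subgraph ?H G"
    using xs(3) by (rule induced_induce)
  ultimately show False
    using free unfolding free_of_def by blast
qed

lemma all_less_5: "(\<forall>i<5. P i) \<longleftrightarrow> P 0 \<and> P 1 \<and> P 2 \<and> P 3 \<and> P (4::nat)"
  by (auto simp: eval_nat_numeral less_Suc_eq)

section \<open>Traces of neighbours and the cliques avoiding a vertex\<close>

locale P5_C5_free_graph = graph +
  assumes P5_free: "free_of (path_graph 5) G"
    and C5_free: "free_of (cycle_graph 5) G"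
begin

lemma dominates_sym: "u \<rightarrow> v \<longleftrightarrow> v \<rightarrow> u"
  using sym_arcs unfolding symmetric_def by (auto dest: symD)

lemma dominates_irrefl: "\<not> u \<rightarrow> u"
  using adj_not_same by blast

text \<open>The hypotheses make \<open>z\<close>, \<open>n\<close>, \<open>u\<close>,
  \<open>x\<close>, \<open>y\<close> a path and leave only the pair \<open>y\<close>,
  \<open>z\<close> open: an edge there closes an induced cycle, a non-edge leaves an induced
  path.\<close>

lemma nested_traces:
  assumes "u \<rightarrow> n" "u \<rightarrow> x" "n \<noteq> x" "\<not> n \<rightarrow> x"
    and y: "x \<rightarrow> y" "\<not> n \<rightarrow> y" "\<not> u \<rightarrow> y" "y \<noteq> u"
    and z: "n \<rightarrow> z" "\<not> x \<rightarrow> z" "\<not> u \<rightarrow> z" "z \<noteq> u"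
  shows False
proof -
  let ?xs = "[z, n, u, x, y]"
  have len: "length ?xs = 5"
    by simp
  have verts: "set ?xs \<subseteq> verts G"
    using assms by (auto dest: adj_in_verts)
  have dist: "distinct ?xs"
    using assms dominates_irrefl dominates_sym by auto
  show False
  proof (cases "y \<rightarrow> z")
    case True
    have "\<not> (\<forall>i<5. \<forall>j<5. ?xs ! i \<rightarrow> ?xs ! j \<longleftrightarrow>
        (i, j) \<in> {(i, j). i < 5 \<and> j < 5 \<and> (j = Suc i mod 5 \<or> i = Suc j mod 5)})"
      using C5_free unfolding cycle_graph_def
      by (intro free_of_not_nth_iff[OF digraph_axioms _ _ dist len verts]) auto
    with assms True show False
      unfolding all_less_5 by (simp add: dominates_irrefl dominates_sym)
  next
    case False
    have "\<not> (\<forall>i<5. \<forall>j<5. ?xs ! i \<rightarrow> ?xs ! j \<longleftrightarrow>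
        (i, j) \<in> {(i, j). i < 5 \<and> j < 5 \<and> (j = Suc i \<or> i = Suc j)})"
      using P5_free unfolding path_graph_def
      by (intro free_of_not_nth_iff[OF digraph_axioms _ _ dist len verts]) auto
    with assms False show False
      unfolding all_less_5 by (simp add: dominates_irrefl dominates_sym)
  qed
qed

text \<open>This is \<open>W(u)\<close> of the overview, taken inside a set \<open>S\<close> because
  components are removed one by one. The size \<open>k\<close> stays fixed meanwhile, even if
  \<open>S\<close> no longer has cliques of that size.\<close>

definition cliques_avoiding :: "'a set \<Rightarrow> nat \<Rightarrow> 'a \<Rightarrow> 'a set set" where
  "cliques_avoiding S k u =
     {K. K \<subseteq> S \<and> clique G K \<and> card K = k \<and> u \<notin> K \<and> (\<forall>x\<in>K. \<not> u \<rightarrow> x)}"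

lemma card_clique_neighbours:
  assumes "S \<subseteq> verts G" and no_large: "\<And>K. clique G K \<Longrightarrow> K \<subseteq> S \<Longrightarrow> card K \<noteq> Suc k"
    and "u \<in> S" "clique G K" "K \<subseteq> S" "\<forall>x\<in>K. u \<rightarrow> x"
  shows "card K \<noteq> k"
proof -
  have "clique G (insert u K)"
    using assms dominates_sym unfolding clique_def by (auto simp: pairwise_insert)
  moreover have "finite K" "u \<notin> K"
    using assms finite_subset[OF _ finite_verts] dominates_irrefl by blast+
  ultimately show ?thesis
    using no_large[of "insert u K"] assms by auto
qed

text \<open>A \<open>k\<close>-clique avoiding \<open>n\<close> but containing a neighbour
  \<open>x\<close> of \<open>u\<close> also contains a non-neighbour \<open>y\<close> of
  \<open>u\<close>. Then \<open>y\<close> is in the trace of \<open>x\<close>, hence in the maximal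
  trace of \<open>n\<close>, a contradiction. The vertex \<open>n\<close> replaces \<open>p\<close>
  on a walk from \<open>u\<close> to \<open>c\<close>.\<close>

lemma cliques_avoiding_maximal_neighbour:
  assumes S: "S \<subseteq> verts G" and no_large: "\<And>K. clique G K \<Longrightarrow> K \<subseteq> S \<Longrightarrow> card K \<noteq> Suc k"
    and "u \<in> S" "p \<in> S" "u \<rightarrow> p" "c \<in> S" "p \<rightarrow> c" "c \<noteq> u" "\<not> u \<rightarrow> c"
  obtains n where "n \<in> S" "u \<rightarrow> n" "n \<rightarrow> c" "cliques_avoiding S k n \<subseteq> cliques_avoiding S k u"
proof -
  define T where "T x = {y \<in> S. x \<rightarrow> y \<and> y \<noteq> u \<and> \<not> u \<rightarrow> y}" for x
  define N where "N = {x \<in> S. u \<rightarrow> x}"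
  have "finite (T ` N)"
    using finite_subset[OF S finite_verts] by (simp add: N_def)
  moreover have "T p \<in> T ` N"
    using assms by (auto simp: N_def)
  ultimately obtain M where M: "M \<in> T ` N" "T p \<subseteq> M" "\<And>L. L \<in> T ` N \<Longrightarrow> M \<subseteq> L \<Longrightarrow> L = M"
    by (metis (no_types, lifting) finite_has_maximal2)
  then obtain n where n: "n \<in> N" "T n = M"
    by auto
  \<comment> \<open>By maximality of \<open>T n\<close>, a failure would make the two traces
    incomparable, which \<open>nested_traces\<close> forbids.\<close>
  have trace: "T x \<subseteq> T n" if "x \<in> N" "x \<noteq> n" "\<not> n \<rightarrow> x" for x
  proof (rule ccontr)
    assume "\<not> T x \<subseteq> T n"
    with M(3)[of "T x"] n that(1) have "\<not> T n \<subseteq> T x"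
      by auto
    with \<open>\<not> T x \<subseteq> T n\<close> obtain y z where "y \<in> T x" "y \<notin> T n" "z \<in> T n" "z \<notin> T x"
      by blast
    then show False
      using nested_traces[of u n x y z] that n(1) unfolding T_def N_def by blast
  qed
  have "cliques_avoiding S k n \<subseteq> cliques_avoiding S k u"
  proof
    fix K
    assume "K \<in> cliques_avoiding S k n"
    then have K: "K \<subseteq> S" "clique G K" "card K = k" "n \<notin> K" "\<forall>x\<in>K. \<not> n \<rightarrow> x"
      by (auto simp: cliques_avoiding_def)
    have "u \<notin> K"
      using K(5) n(1) dominates_sym by (auto simp: N_def)
    moreover have "\<not> u \<rightarrow> x" if x: "x \<in> K" for x
    proof
      assume "u \<rightarrow> x"
      \<comment> \<open>Otherwise \<open>u\<close> would extend \<open>K\<close> to a clique of size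
        \<open>Suc k\<close>.\<close>
      have "\<exists>y\<in>K. \<not> u \<rightarrow> y"
        using card_clique_neighbours[OF S no_large] K assms(3) by blast
      then obtain y where y: "y \<in> K" "\<not> u \<rightarrow> y"
        by blast
      with x \<open>u \<rightarrow> x\<close> K(2) have "x \<rightarrow> y"
        by (auto simp: clique_def pairwise_def)
      with y \<open>u \<notin> K\<close> K(1) have "y \<in> T x"
        by (auto simp: T_def)
      moreover have "T x \<subseteq> T n"
        using trace[of x] x \<open>u \<rightarrow> x\<close> K by (auto simp: N_def)
      ultimately show False
        using K(5) y(1) by (auto simp: T_def)
    qed
    ultimately show "K \<in> cliques_avoiding S k u"
      using K by (simp add: cliques_avoiding_def)
  qed
  moreover have "c \<in> T n"
    using M(2) n(2) assms by (auto simp: T_def)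
  ultimately show thesis
    using n(1) by (intro that[of n]) (auto simp: N_def T_def)
qed

text \<open>By induction on the length of the walk: there is always a shorter walk to
  \<open>b\<close> from a vertex with the same set \<open>W\<close>.\<close>

lemma minimal_cliques_avoiding_unreachable:
  assumes S: "S \<subseteq> verts G" and no_large: "\<And>K. clique G K \<Longrightarrow> K \<subseteq> S \<Longrightarrow> card K \<noteq> Suc k"
    and minimal: "\<And>w. w \<in> S \<Longrightarrow> cliques_avoiding S k w \<subseteq> W \<Longrightarrow> cliques_avoiding S k w = W"
    and "K \<in> W" "b \<in> K"
    and "u \<in> S" "cliques_avoiding S k u = W" "(u, b) \<in> (Restr (arcs_ends G) S) ^^ d"
  shows False
  using assms(6-)
proof (induction d arbitrary: u rule: less_induct)
  case (less d)
  let ?E = "Restr (arcs_ends G) S"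
  \<comment> \<open>As \<open>K\<close> avoids \<open>u\<close>, its vertex \<open>b\<close> is
    neither \<open>u\<close> nor a neighbour of \<open>u\<close>, so the walk has at least two
    steps.\<close>
  have b: "b \<noteq> u" "\<not> u \<rightarrow> b"
    using assms(4,5) less.prems(2) by (auto simp: cliques_avoiding_def)
  with less.prems(3) obtain e where d: "d = Suc e"
    by (cases d) auto
  with less.prems(3) obtain p where p: "(u, p) \<in> ?E" "(p, b) \<in> ?E ^^ e"
    by (metis relpow_Suc_D2)
  with b obtain e' where e: "e = Suc e'"
    by (cases e) auto
  with p(2) obtain c where c: "(p, c) \<in> ?E" "(c, b) \<in> ?E ^^ e'"
    by (metis relpow_Suc_D2)
  \<comment> \<open>The walk need not be shortest. The first two cases shortcut it; in the third,
    minimality of \<open>W\<close> makes \<open>n\<close> as good a start as \<open>u\<close>, one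
    step closer to \<open>b\<close>.\<close>
  consider "c = u" | "u \<rightarrow> c" | "c \<noteq> u" "\<not> u \<rightarrow> c"
    by blast
  then show False
  proof cases
    case 1
    then show False
      using less.IH[of e' u] less.prems c d e by simp
  next
    case 2
    then have "(u, b) \<in> ?E ^^ e"
      using c p(1) relpow_Suc_I2[of u c ?E b e'] unfolding e by blast
    then show False
      using less.IH[of e u] less.prems d by simp
  next
    case 3
    then obtain n where n: "n \<in> S" "u \<rightarrow> n" "n \<rightarrow> c" "cliques_avoiding S k n \<subseteq> cliques_avoiding S k u"
      using cliques_avoiding_maximal_neighbour[OF S no_large less.prems(1), of p c] p(1) c(1) by blast
    then have "cliques_avoiding S k n = W"
      using minimal less.prems(2) by blast
    moreover have "(n, b) \<in> ?E ^^ e"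
      using n(1,3) c relpow_Suc_I2[of n c ?E b e'] unfolding e by blast
    ultimately show False
      using less.IH[of e n] n(1) d by simp
  qed
qed

section \<open>Partition, one component at a time\<close>

lemma clique_subset_closed:
  assumes "clique G K" "K \<subseteq> S" "x \<in> K" "x \<in> R" "\<And>y z. y \<in> R \<Longrightarrow> z \<in> S \<Longrightarrow> y \<rightarrow> z \<Longrightarrow> z \<in> R"
  shows "K \<subseteq> R"
proof
  fix y
  assume "y \<in> K"
  then have "y = x \<or> x \<rightarrow> y"
    using assms(1,3) by (auto simp: clique_def pairwise_def)
  with \<open>y \<in> K\<close> assms(2,4,5) show "y \<in> R"
    by auto
qed

text \<open>Having no clique of size \<open>Suc k\<close> passes to subsets, whereas having clique
  number \<open>k\<close> does not; this form lets the induction continue on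
  \<open>S - R\<close>.\<close>

lemma partition_without_large_cliques:
  assumes "S \<subseteq> verts G" "k \<ge> 2" "\<And>K. clique G K \<Longrightarrow> K \<subseteq> S \<Longrightarrow> card K \<noteq> Suc k"
  shows "\<exists>A B. A \<union> B = S \<and> A \<inter> B = {} \<and>
    (\<forall>K. clique G K \<longrightarrow> K \<subseteq> A \<or> K \<subseteq> B \<longrightarrow> card K \<noteq> k)"
  using finite_subset[OF assms(1) finite_verts] assms(1,3)
proof (induction S rule: finite_psubset_induct)
  case (psubset S)
  show ?case
  proof (cases "S = {}")
    case True
    with \<open>k \<ge> 2\<close> show ?thesis
      by auto
  next
    case False
    obtain W where W: "W \<in> cliques_avoiding S k ` S"
      "\<And>V. V \<in> cliques_avoiding S k ` S \<Longrightarrow> V \<subseteq> W \<Longrightarrow> V = W"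
      using finite_has_minimal[of "cliques_avoiding S k ` S"] False psubset.hyps
      by (metis finite_imageI image_is_empty)
    then obtain v where v: "v \<in> S" "cliques_avoiding S k v = W"
      by blast
    \<comment> \<open>The component of \<open>v\<close> in the subgraph induced by
      \<open>S\<close>.\<close>
    define R where "R = {x. (v, x) \<in> (Restr (arcs_ends G) S)\<^sup>*}"
    have "R \<subseteq> S"
      using v(1) by (auto simp: R_def elim: rtranclE)
    have "v \<in> R"
      by (simp add: R_def)
    have R_closed: "z \<in> R" if "y \<in> R" "z \<in> S" "y \<rightarrow> z" for y z
      using that \<open>R \<subseteq> S\<close> by (auto simp: R_def intro: rtrancl_into_rtrancl)
    have "S - R \<subset> S"
      using v(1) \<open>v \<in> R\<close> by blast
    then have "\<exists>A B. A \<union> B = S - R \<and> A \<inter> B = {} \<and>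
        (\<forall>K. clique G K \<longrightarrow> K \<subseteq> A \<or> K \<subseteq> B \<longrightarrow> card K \<noteq> k)"
      using psubset.prems by (intro psubset.IH) blast+
    then obtain A B where AB: "A \<union> B = S - R" "A \<inter> B = {}"
      and small: "\<And>K. clique G K \<Longrightarrow> K \<subseteq> A \<or> K \<subseteq> B \<Longrightarrow> card K \<noteq> k"
      by blast
    let ?N = "{x \<in> R. v \<rightarrow> x}"
    \<comment> \<open>A clique in \<open>S\<close> that meets \<open>R\<close> lies within
      \<open>R\<close>, so joining a part of \<open>S - R\<close> with a part of \<open>R\<close>
      creates no new cliques.\<close>
    have split: "K \<subseteq> D \<or> K \<subseteq> R \<inter> C" if "clique G K" "K \<subseteq> D \<union> C" "D \<subseteq> S - R" "C \<subseteq> R" for K C D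
    proof (cases "K \<inter> R = {}")
      case False
      then obtain x where "x \<in> K" "x \<in> R"
        by blast
      moreover have "K \<subseteq> S"
        using that(2-4) \<open>R \<subseteq> S\<close> by blast
      ultimately have "K \<subseteq> R"
        using clique_subset_closed[OF that(1)] R_closed by metis
      with that show ?thesis
        by blast
    qed (use that in blast)
    have N: "card K \<noteq> k" if "clique G K" "K \<subseteq> ?N" for K
      using card_clique_neighbours[of S k v K] psubset.prems v(1) that \<open>R \<subseteq> S\<close> by blast
    \<comment> \<open>A clique containing \<open>v\<close> here is just \<open>{v}\<close>, too
      small since \<open>k \<ge> 2\<close>. Any other of size \<open>k\<close> avoids
      \<open>v\<close>, so it is in \<open>W\<close> yet reachable from \<open>v\<close>.\<close>
    have M: "card K \<noteq> k" if K: "clique G K" "K \<subseteq> R - ?N" for K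
    proof
      assume "card K = k"
      show False
      proof (cases "v \<in> K")
        case True
        with K have "K = {v}"
          by (auto simp: clique_def pairwise_def)
        with \<open>card K = k\<close> \<open>k \<ge> 2\<close> show False
          by simp
      next
        case False
        with K \<open>card K = k\<close> \<open>R \<subseteq> S\<close> v(2) have "K \<in> W"
          by (auto simp: cliques_avoiding_def)
        moreover obtain b where "b \<in> K"
          using \<open>card K = k\<close> \<open>k \<ge> 2\<close> by fastforce
        moreover then obtain d where "(v, b) \<in> (Restr (arcs_ends G) S) ^^ d"
          using K(2) rtrancl_imp_relpow unfolding R_def by blast
        ultimately show False
          using minimal_cliques_avoiding_unreachable[of S k W K b v d] psubset.prems W(2) v by blast
      qed
    qed
    have "(A \<union> ?N) \<union> (B \<union> (R - ?N)) = S" "(A \<union> ?N) \<inter> (B \<union> (R - ?N)) = {}"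
      using AB \<open>R \<subseteq> S\<close> by blast+
    moreover have "card K \<noteq> k" if "clique G K" "K \<subseteq> A \<union> ?N \<or> K \<subseteq> B \<union> (R - ?N)" for K
      using that(2)
    proof
      assume "K \<subseteq> A \<union> ?N"
      with split[OF that(1), of A ?N] AB have "K \<subseteq> A \<or> K \<subseteq> ?N"
        by blast
      with small N that(1) show ?thesis
        by blast
    next
      assume "K \<subseteq> B \<union> (R - ?N)"
      with split[OF that(1), of B "R - ?N"] AB have "K \<subseteq> B \<or> K \<subseteq> R - ?N"
        by blast
      with small M that(1) show ?thesis
        by blast
    qed
    ultimately show ?thesis
      by blast
  qed
qed

end

theorem theorem2p1:
  fixes G :: "('a, 'b) pre_digraph"
  assumes "graph G"
    and "free_of (path_graph 5) G"
    and "free_of (cycle_graph 5) G"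
  shows "two_divisible G"
proof -
  interpret P5_C5_free_graph G
    using assms by (simp add: P5_C5_free_graph_def P5_C5_free_graph_axioms_def)
  show ?thesis
    unfolding two_divisible_def
  proof (intro allI impI, elim conjE)
    fix H
    assume ind: "induced_subgraph H G" and "arcs H \<noteq> {}"
    have VG: "verts H \<subseteq> verts G" and wfH: "wf_digraph H"
      using ind by (auto simp: induced_subgraph_def subgraph_def)
    have fin: "finite (verts H)"
      using VG finite_verts by (rule finite_subset)
    have dom: "u \<rightarrow>\<^bsub>H\<^esub> v \<longleftrightarrow> u \<rightarrow>\<^bsub>G\<^esub> v \<and> u \<in> verts H \<and> v \<in> verts H" for u v
      using ind by (auto simp: induced_subgraph_def subgraph_def compatible_def arcs_ends_conv)
    have clique_H: "clique H K \<longleftrightarrow> clique G K \<and> K \<subseteq> verts H" for K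
      using VG dom unfolding clique_def pairwise_def by auto
    let ?k = "clique_number H"
    \<comment> \<open>The two ends of an arc form a clique, which gives the bound
      \<open>?k \<ge> 2\<close> needed for the partition.\<close>
    obtain e where "e \<in> arcs H"
      using \<open>arcs H \<noteq> {}\<close> by blast
    then have e: "tail H e \<rightarrow>\<^bsub>H\<^esub> head H e"
      by (auto simp: arcs_ends_conv)
    then have "clique H {tail H e, head H e}"
      using dom dominates_sym by (auto simp: clique_def pairwise_insert)
    moreover have "tail H e \<noteq> head H e"
      using e dom dominates_irrefl by metis
    ultimately have "?k \<ge> 2"
      using card_le_clique_number[OF fin, of "{tail H e, head H e}"] by simp
    moreover have "card K \<noteq> Suc ?k" if "clique G K" "K \<subseteq> verts H" for K
      using card_le_clique_number[OF fin, of K] that clique_H by auto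
    ultimately have "\<exists>A B. A \<union> B = verts H \<and> A \<inter> B = {} \<and>
        (\<forall>K. clique G K \<longrightarrow> K \<subseteq> A \<or> K \<subseteq> B \<longrightarrow> card K \<noteq> ?k)"
      by (rule partition_without_large_cliques[OF VG])
    then obtain A B where AB: "A \<union> B = verts H" "A \<inter> B = {}"
      and small: "\<And>K. clique G K \<Longrightarrow> K \<subseteq> A \<or> K \<subseteq> B \<Longrightarrow> card K \<noteq> ?k"
      by blast
    have "clique_number (H \<restriction> C) < ?k" if "C = A \<or> C = B" for C
    proof (rule clique_number_less)
      have "C \<subseteq> verts H"
        using that AB(1) by blast
      then show "finite (verts (H \<restriction> C))"
        using fin by (simp add: finite_subset)
      show "card K \<noteq> ?k" if "clique (H \<restriction> C) K" for K
        using that clique_induce_subgraph_iff[OF wfH \<open>C \<subseteq> verts H\<close>] clique_H small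
          \<open>C = A \<or> C = B\<close> by blast
    qed
    with AB show "\<exists>A B. A \<union> B = verts H \<and> A \<inter> B = {} \<and>
        clique_number (H \<restriction> A) < clique_number H \<and> clique_number (H \<restriction> B) < clique_number H"
      by blast
  qed
qed

end
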